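(* If $\mathcal{H}$ is a $k$-uniform hypergraph on $n$ vertices with $m$ edges, then $\mathtt{BE}(\mathcal{H}) \le \sqrt{\mathfrak{Z}(\mathcal{H})} + \sqrt{(n-1)(km-\mathfrak{Z}(\mathcal{H}))}$, where $\mathfrak{Z}(\mathcal{H}) = k\sqrt{\frac{1}{n}Z(\mathcal{H})}$. Also, if $\mathcal{H}$ is the complete $k$-uniform hypergraph, then equality holds.
   Context: A hypergraph $\mathcal{H}=(V,E)$ has a finite vertex set $V$ and an edge set $E\subseteq 2^V$; it is $k$-uniform ($k\ge2$) if every edge has exactly $k$ vertices. The degree $d(v)$ of a vertex is the number of edges containing $v$. The Zagreb index is $Z(\mathcal{H})=\sum_{v\in V}d(v)^2$. Its incidence matrix $\mathbf{B}$ is the $|V|\times|E|$ matrix with $b(v,e)=1$ if $v\in e$ and $0$ otherwise. The incidence energy $\mathtt{BE}(\mathcal{H})$ is the sum of the singular values of $\mathbf{B}$ (i.e. of the square roots of the eigenvalues of $\mathbf{B}\mathbf{B}^T$) if $\mathcal{H}$ has at least one edge, and $0$ otherwise. The complete $k$-uniform hypergraph on $n$ vertices has all $k$-subsets of the vertex set as edges. *)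

theory Defs
  imports "Jordan_Normal_Form.Char_Poly" "HOL-Library.Countable_Set"
begin

definition hypergraph :: "'a set \<Rightarrow> 'a set set \<Rightarrow> bool" where
  "hypergraph V E \<longleftrightarrow> finite V \<and> E \<subseteq> Pow V"

definition uniform_hypergraph :: "nat \<Rightarrow> 'a set \<Rightarrow> 'a set set \<Rightarrow> bool" where
  "uniform_hypergraph k V E \<longleftrightarrow> hypergraph V E \<and> k \<ge> 2 \<and> (\<forall>e\<in>E. card e = k)"

definition complete_uniform_hypergraph :: "nat \<Rightarrow> 'a set \<Rightarrow> 'a set set \<Rightarrow> bool" where
  "complete_uniform_hypergraph k V E \<longleftrightarrow>
     uniform_hypergraph k V E \<and> E = {e. e \<subseteq> V \<and> card e = k}"

definition hdegree :: "'a set set \<Rightarrow> 'a \<Rightarrow> nat" where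
  "hdegree E v = card {e \<in> E. v \<in> e}"

definition zagreb_index :: "'a set \<Rightarrow> 'a set set \<Rightarrow> nat" where
  "zagreb_index V E = (\<Sum>v\<in>V. (hdegree E v)\<^sup>2)"

text \<open>For a finite set \<open>S\<close>, \<open>from_nat_into S\<close> is a bijection from \<open>{..<card S}\<close> onto \<open>S\<close>, used here to
  number the rows by vertices and the columns by edges. Another numbering permutes rows and columns,
  which does not affect the singular values.\<close>
definition incidence_matrix :: "'a set \<Rightarrow> 'a set set \<Rightarrow> real mat" where
  "incidence_matrix V E = mat (card V) (card E)
     (\<lambda>(i, j). if from_nat_into V i \<in> from_nat_into E j then 1 else 0)"

text \<open>The eigenvalues of \<open>B * B\<^sup>T\<close> with multiplicity are the roots of its characteristic polynomial;
  they are all real since the matrix is symmetric.\<close>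
definition singular_values :: "real mat \<Rightarrow> real multiset" where
  "singular_values B = image_mset sqrt (proots (char_poly (B * transpose_mat B)))"

definition incidence_energy :: "'a set \<Rightarrow> 'a set set \<Rightarrow> real" where
  "incidence_energy V E =
     (if E = {} then 0 else sum_mset (singular_values (incidence_matrix V E)))"

definition frak_zagreb :: "nat \<Rightarrow> 'a set \<Rightarrow> 'a set set \<Rightarrow> real" where
  "frak_zagreb k V E = real k * sqrt (1 / real (card V) * real (zagreb_index V E))"

end

theory Submission
  imports Defs "Jordan_Normal_Form.Schur_Decomposition"
begin

text \<open>Let \<open>M = B B\<^sup>T\<close>. By the spectral theorem \<open>M\<close> has nonnegative eigenvalues
  \<open>\<lambda>\<^sub>1 \<ge> \<dots> \<ge> \<lambda>\<^sub>n\<close> with sum \<open>tr M = k m\<close>. Since \<open>M 1 = k d\<close> for the degree vector \<open>d\<close>,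
  comparing norms gives \<open>\<lambda>\<^sub>1 \<ge> z\<close>, where \<open>z = k \<surd>(Z/n)\<close>, and \<open>z \<ge> k m / n\<close> by Cauchy-Schwarz.
  Cauchy-Schwarz on the remaining eigenvalues bounds the energy by
  \<open>\<surd>\<lambda>\<^sub>1 + \<surd>((n - 1) (k m - \<lambda>\<^sub>1))\<close>, which is decreasing in \<open>\<lambda>\<^sub>1\<close> beyond \<open>k m / n\<close>.
  For the complete hypergraph \<open>M = (a - b) I + b J\<close> with degree \<open>a\<close> and codegree \<open>b\<close>, so its only eigenvalues are
  \<open>k a\<close> and \<open>a - b\<close>, and the trace forces \<open>k a\<close> to be simple.\<close>

section \<open>Spectral theorem for real symmetric matrices\<close>

text \<open>The characteristic polynomial splits over the complex numbers. For a complex eigenpair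
  \<open>z\<close>, \<open>v\<close>, moving the symmetric matrix across the Hermitian product shows
  that \<open>z\<close> equals its conjugate, so a real root exists.\<close>

lemma symmetric_real_eigenvalue:
  fixes A :: "real mat"
  assumes A: "A \<in> carrier_mat n n" and sym: "A\<^sup>T = A" and n: "n > 0"
  shows "\<exists>e. eigenvalue A e"
proof -
  let ?A = "map_mat complex_of_real A"
  have cA: "?A \<in> carrier_mat n n" using A by simp
  obtain as where as: "char_poly ?A = (\<Prod>a\<leftarrow>as. [:- a, 1:])" "length as = n"
    using char_poly_factorized[OF cA] by blast
  then obtain z where "z \<in> set as" using n by (cases as) auto
  then have root: "poly (char_poly ?A) z = 0"
    unfolding as(1) by (induction as) auto
  then have "eigenvalue ?A z" using eigenvalue_root_char_poly[OF cA] by simp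
  then obtain v where v: "v \<in> carrier_vec n" "v \<noteq> 0\<^sub>v n" and Av: "?A *\<^sub>v v = z \<cdot>\<^sub>v v"
    using cA unfolding eigenvalue_def eigenvector_def by auto
  \<comment> \<open>The entries of \<open>A\<close> are real, so the matrix commutes with
    conjugation.\<close>
  have conj: "conjugate (?A *\<^sub>v v) = ?A *\<^sub>v conjugate v"
    by (rule eq_vecI) (use A v in \<open>auto simp: scalar_prod_def sum_conjugate conjugate_dist_mul\<close>)
  have "z * (v \<bullet>c v) = (?A *\<^sub>v v) \<bullet>c v" unfolding Av using v by simp
  also have "\<dots> = v \<bullet> (?A *\<^sub>v conjugate v)"
    using transpose_vec_mult_scalar[of ?A n n "conjugate v" v] v cA
    by (simp add: map_mat_transpose sym)
  also have "\<dots> = v \<bullet> conjugate (z \<cdot>\<^sub>v v)" by (simp add: conj[symmetric] Av)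
  also have "\<dots> = cnj z * (v \<bullet>c v)" using v by (simp add: conjugate_smult_vec)
  finally have "z = cnj z" using v by simp
  then obtain e where e: "z = complex_of_real e"
    by (intro that[of "Re z"]) (simp add: complex_eq_iff)
  have "char_poly ?A = map_poly complex_of_real (char_poly A)"
    by (rule of_real_hom.char_poly_hom[OF A])
  with root have "poly (char_poly A) e = 0" unfolding e by simp
  then show ?thesis using eigenvalue_root_char_poly[OF A] by blast
qed

text \<open>Complete \<open>v\<close> to a basis, apply Gram-Schmidt, which keeps the first vector,
  and normalise. The scalar \<open>c\<close> absorbs the normalisation; a multiple of an eigenvector
  serves equally well below.\<close>

lemma orthogonal_mat_with_first_col:
  fixes v :: "real vec"
  assumes v: "v \<in> carrier_vec n" and v0: "v \<noteq> 0\<^sub>v n"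
  shows "\<exists>W c. W \<in> carrier_mat n n \<and> W\<^sup>T * W = 1\<^sub>m n \<and> col W 0 = c \<cdot>\<^sub>v v"
proof -
  interpret cof_vec_space n "TYPE(real)" .
  define b where "b = basis_completion v"
  define ws where "ws = gram_schmidt n b"
  from basis_completion[OF v v0, folded b_def]
  have dist_b: "distinct b" and indep: "\<not> lin_dep (set b)" and b: "set b \<subseteq> carrier_vec n"
    and hdb: "hd b = v" and len_b: "length b = n" by auto
  have n: "n > 0" using v v0 by (cases n) auto
  from hdb len_b n obtain vs where bv: "b = v # vs" by (cases b) auto
  from gram_schmidt_result[OF b dist_b indep refl, folded ws_def]
  have ws: "set ws \<subseteq> carrier_vec n" "corthogonal ws" "length ws = n"
    by (auto simp: len_b)
  have hdws: "ws ! 0 = v"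
    using gram_schmidt_hd[OF v, of vs, folded bv] ws(3) n
    unfolding ws_def[symmetric] by (metis hd_conv_nth length_greater_0_conv)
  have wsn: "ws ! i \<in> carrier_vec n" if "i < n" for i using ws that by auto
  define c where "c i = 1 / sqrt (ws ! i \<bullet> ws ! i)" for i
  define W where "W = mat n n (\<lambda>(i, j). c j * (ws ! j) $ i)"
  have W: "W \<in> carrier_mat n n" by (simp add: W_def)
  have colW: "col W j = c j \<cdot>\<^sub>v ws ! j" if "j < n" for j
    by (rule eq_vecI) (use that wsn[OF that] in \<open>auto simp: W_def\<close>)
  have prod: "col W i \<bullet> col W j = (if i = j then 1 else 0)" if ij: "i < n" "j < n" for i j
  proof -
    have eq: "col W i \<bullet> col W j = c i * c j * (ws ! i \<bullet> ws ! j)"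
      using ij wsn[OF ij(1)] wsn[OF ij(2)] by (simp add: colW)
    \<comment> \<open>The case \<open>i = j\<close> says that no vector of \<open>ws\<close> is
      null, so the norms in \<open>c\<close> can be divided by.\<close>
    have orth: "ws ! i \<bullet> ws ! j = 0 \<longleftrightarrow> i \<noteq> j"
      using corthogonalD[OF ws(2), of i j] ij ws(3) by simp
    have "ws ! i \<bullet> ws ! i \<ge> 0" by (simp add: scalar_prod_def sum_nonneg)
    then show ?thesis unfolding eq using orth by (auto simp: c_def)
  qed
  have "W\<^sup>T * W = 1\<^sub>m n"
    by (rule eq_matI) (use W prod in auto)
  then show ?thesis using W colW[OF n] hdws by metis
qed

text \<open>Deflation: in an orthonormal basis that starts with an eigenvector the matrix splits
  into the eigenvalue and a smaller symmetric block, to which the induction hypothesis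
  applies.\<close>

theorem symmetric_real_diagonalization:
  fixes A :: "real mat"
  assumes "A \<in> carrier_mat n n" and "A\<^sup>T = A"
  shows "\<exists>P f. P \<in> carrier_mat n n \<and> P\<^sup>T * P = 1\<^sub>m n \<and> P\<^sup>T * A * P = mat_diag n f"
  using assms
proof (induction n arbitrary: A)
  case 0
  then show ?case by (intro exI[of _ "1\<^sub>m 0"] exI[of _ "\<lambda>_. 0"]) (auto simp: mat_diag_def)
next
  case (Suc n)
  note A = Suc.prems(1) and sym = Suc.prems(2)
  obtain e v where v: "v \<in> carrier_vec (Suc n)" "v \<noteq> 0\<^sub>v (Suc n)" and Av: "A *\<^sub>v v = e \<cdot>\<^sub>v v"
    using symmetric_real_eigenvalue[OF A sym] A unfolding eigenvalue_def eigenvector_def by auto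
  obtain W c where W: "W \<in> carrier_mat (Suc n) (Suc n)" and WW: "W\<^sup>T * W = 1\<^sub>m (Suc n)"
    and W0: "col W 0 = c \<cdot>\<^sub>v v"
    using orthogonal_mat_with_first_col[OF v] by blast
  define M where "M = W\<^sup>T * A * W"
  have M: "M \<in> carrier_mat (Suc n) (Suc n)" using W A by (simp add: M_def)
  have Wt: "W\<^sup>T \<in> carrier_mat (Suc n) (Suc n)" using W by simp
  have MT: "M\<^sup>T = M"
    unfolding M_def using W A sym Wt
    by (simp add: transpose_mult[of _ "Suc n" "Suc n" _ "Suc n"]
        assoc_mult_mat[of _ "Suc n" "Suc n" _ "Suc n" _ "Suc n"])
  have Msym: "M $$ (i, j) = M $$ (j, i)" if "i < Suc n" "j < Suc n" for i j
    using that M by (subst MT[symmetric]) simp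
  \<comment> \<open>The first column of \<open>W\<close> is an eigenvector and is orthogonal to the
    other columns; symmetry then clears the first row too.\<close>
  have col0: "M $$ (i, 0) = (if i = 0 then e else 0)" if i: "i < Suc n" for i
  proof -
    have "A *\<^sub>v col W 0 = e \<cdot>\<^sub>v col W 0" unfolding W0 using v A Av
      by (simp add: mult_mat_vec[OF A] smult_smult_assoc mult.commute)
    then have "col (A * W) 0 = e \<cdot>\<^sub>v col W 0" using col_mult2[OF A W, of 0] by simp
    moreover have "M $$ (i, 0) = row (W\<^sup>T) i \<bullet> col (A * W) 0"
      unfolding M_def assoc_mult_mat[OF Wt A W] by (rule index_mult_mat) (use i W A in simp_all)
    ultimately have "M $$ (i, 0) = row (W\<^sup>T) i \<bullet> (e \<cdot>\<^sub>v col W 0)" by simp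
    also have "\<dots> = e * (W\<^sup>T * W) $$ (i, 0)" using i W by simp
    finally show ?thesis unfolding WW using i by simp
  qed
  define A3 where "A3 = mat n n (\<lambda>(i, j). M $$ (Suc i, Suc j))"
  have A3: "A3 \<in> carrier_mat n n" by (simp add: A3_def)
  have "A3\<^sup>T = A3" by (rule eq_matI) (auto simp: A3_def Msym)
  from Suc.IH[OF A3 this] obtain P f where P: "P \<in> carrier_mat n n" and PP: "P\<^sup>T * P = 1\<^sub>m n"
    and PA: "P\<^sup>T * A3 * P = mat_diag n f" by blast
  have Mblock: "M = four_block_mat (mat 1 1 (\<lambda>_. e)) (0\<^sub>m 1 n) (0\<^sub>m n 1) A3"
    by (rule eq_matI) (use M col0 Msym[of 0] in \<open>auto simp: A3_def\<close>)
  \<comment> \<open>The diagonaliser of the lower block, extended by the identity on the first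
    coordinate; \<open>W * ?Q\<close> will be the witness.\<close>
  let ?Q = "four_block_mat (1\<^sub>m 1) (0\<^sub>m 1 n) (0\<^sub>m n 1) P"
  have Q: "?Q \<in> carrier_mat (Suc n) (Suc n)" using P four_block_carrier_mat[of "1\<^sub>m 1" 1 1 P n n] by simp
  have Pt: "P\<^sup>T \<in> carrier_mat n n" using P by simp
  have Qt: "?Q\<^sup>T = four_block_mat (1\<^sub>m 1) (0\<^sub>m 1 n) (0\<^sub>m n 1) (P\<^sup>T)"
    using P by (subst transpose_four_block_mat[of _ 1 1 _ n _ n]) auto
  have QQ: "?Q\<^sup>T * ?Q = 1\<^sub>m (Suc n)"
    unfolding Qt using P Pt PP
    by (subst mult_four_block_mat[of _ 1 1 _ n _ n _ _ 1 _ n]) auto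
  have "?Q\<^sup>T * M = four_block_mat (mat 1 1 (\<lambda>_. e)) (0\<^sub>m 1 n) (0\<^sub>m n 1) (P\<^sup>T * A3)"
    unfolding Qt Mblock using P Pt A3
    by (subst mult_four_block_mat[of _ 1 1 _ n _ n _ _ 1 _ n]) auto
  also have "\<dots> * ?Q = four_block_mat (mat 1 1 (\<lambda>_. e)) (0\<^sub>m 1 n) (0\<^sub>m n 1) (mat_diag n f)"
    unfolding PA[symmetric] using P Pt A3
    by (subst mult_four_block_mat[of _ 1 1 _ n _ n _ _ 1 _ n]) auto
  also have "\<dots> = mat_diag (Suc n) (case_nat e f)"
    by (rule eq_matI) (auto simp: mat_diag_def split: nat.split)
  finally have QMQ: "?Q\<^sup>T * M * ?Q = mat_diag (Suc n) (case_nat e f)" .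
  note as = assoc_mult_mat[of _ "Suc n" "Suc n" _ "Suc n" _ "Suc n"]
  have WQ: "(W * ?Q)\<^sup>T = ?Q\<^sup>T * W\<^sup>T" by (rule transpose_mult[OF W Q])
  have Qt': "?Q\<^sup>T \<in> carrier_mat (Suc n) (Suc n)" using Q by simp
  define R where "R = ?Q"
  have "R\<^sup>T * W\<^sup>T * (W * R) = R\<^sup>T * (W\<^sup>T * W) * R"
    using Q Qt' W Wt unfolding R_def[symmetric] by (simp add: as del: transpose_carrier_mat)
  then have 1: "(W * ?Q)\<^sup>T * (W * ?Q) = 1\<^sub>m (Suc n)"
    unfolding WQ WW using QQ Q Qt' unfolding R_def[symmetric] by simp
  have "R\<^sup>T * W\<^sup>T * A * (W * R) = R\<^sup>T * M * R"
    using Q Qt' W Wt A unfolding R_def[symmetric] M_def by (simp add: as del: transpose_carrier_mat)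
  then have 2: "(W * ?Q)\<^sup>T * A * (W * ?Q) = mat_diag (Suc n) (case_nat e f)"
    unfolding WQ using QMQ unfolding R_def by simp
  show ?case using 1 2 W Q mult_carrier_mat[OF W Q] by blast
qed

text \<open>The transpose of \<open>P\<close> is its inverse, so \<open>A\<close> is similar to the
  diagonal matrix and has the same characteristic polynomial. This links the multiset of roots, on
  which singular values are based, to \<open>f\<close>.\<close>

lemma proots_char_poly_orthogonal_diagonalization:
  fixes A :: "real mat"
  assumes A: "A \<in> carrier_mat n n" and P: "P \<in> carrier_mat n n"
    and PP: "P\<^sup>T * P = 1\<^sub>m n" and PAP: "P\<^sup>T * A * P = mat_diag n f"
  shows "proots (char_poly A) = mset (map f [0..<n])"
proof -
  have PT: "P\<^sup>T \<in> carrier_mat n n" using P by simp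
  have PP': "P * P\<^sup>T = 1\<^sub>m n" by (rule mat_mult_left_right_inverse[OF PT P PP])
  have "similar_mat_wit (mat_diag n f) A (P\<^sup>T) P"
    by (rule similar_mat_witI[of _ _ n]) (use A P PT PP PP' PAP in auto)
  then have "similar_mat (mat_diag n f) A" unfolding similar_mat_def by blast
  then have "char_poly A = char_poly (mat_diag n f)" by (rule char_poly_similar[symmetric])
  also have "\<dots> = (\<Prod>a\<leftarrow>diag_mat (mat_diag n f). [:- a, 1:])"
    by (rule char_poly_upper_triangular[of _ n]) (auto simp: mat_diag_def)
  also have "diag_mat (mat_diag n f) = map f [0..<n]"
    by (auto simp: diag_mat_def mat_diag_def)
  finally have "char_poly A = (\<Prod>a\<leftarrow>map f [0..<n]. [:- a, 1:])" .
  moreover have "proots (\<Prod>a\<leftarrow>as. [:- a, 1:]) = mset as" for as :: "real list"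
  proof (induction as)
    case (Cons a as)
    have "(\<Prod>a\<leftarrow>as. [:- a, 1:]) \<noteq> 0" by (auto simp: prod_list_zero_iff)
    then show ?case using Cons by (simp add: proots_mult del: mult_pCons_left)
  qed simp
  ultimately show ?thesis by metis
qed

text \<open>The spectral theorem in the form used for the Gram matrix: roots with multiplicity,
  trace, unit eigenvectors (the columns of \<open>P\<close>), and Parseval's identity.\<close>

lemma symmetric_real_eigenbasis:
  fixes A :: "real mat"
  assumes A: "A \<in> carrier_mat n n" and sym: "A\<^sup>T = A"
  obtains f u where "proots (char_poly A) = mset (map f [0..<n])"
    and "(\<Sum>i<n. f i) = (\<Sum>i<n. A $$ (i, i))"
    and "\<And>i. i < n \<Longrightarrow> u i \<in> carrier_vec n"
    and "\<And>i. i < n \<Longrightarrow> u i \<bullet> u i = 1"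
    and "\<And>i. i < n \<Longrightarrow> A *\<^sub>v u i = f i \<cdot>\<^sub>v u i"
    and "\<And>x. x \<in> carrier_vec n \<Longrightarrow> x \<bullet> x = (\<Sum>i<n. (u i \<bullet> x)\<^sup>2)"
proof -
  obtain P f where P: "P \<in> carrier_mat n n" and PP: "P\<^sup>T * P = 1\<^sub>m n"
    and PAP: "P\<^sup>T * A * P = mat_diag n f"
    using symmetric_real_diagonalization[OF A sym] by blast
  have PT: "P\<^sup>T \<in> carrier_mat n n" using P by simp
  have PP': "P * P\<^sup>T = 1\<^sub>m n" by (rule mat_mult_left_right_inverse[OF PT P PP])
  have AP: "A * P = P * mat_diag n f"
  proof -
    have "P * mat_diag n f = (P * P\<^sup>T) * (A * P)"
      unfolding PAP[symmetric] using A P PT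
      by (simp add: assoc_mult_mat[of _ n n _ n _ n] del: transpose_carrier_mat)
    then show ?thesis unfolding PP' using A P by simp
  qed
  show thesis
  proof (rule that[of f "col P"])
    show "proots (char_poly A) = mset (map f [0..<n])"
      by (rule proots_char_poly_orthogonal_diagonalization[OF A P PP PAP])
    show "A *\<^sub>v col P i = f i \<cdot>\<^sub>v col P i" if i: "i < n" for i
    proof -
      have "A *\<^sub>v col P i = col (A * P) i" by (rule col_mult2[OF A P i, symmetric])
      also have "\<dots> = f i \<cdot>\<^sub>v col P i" unfolding AP mat_diag_mult_right[OF P]
        by (rule eq_vecI) (use P i in auto)
      finally show ?thesis .
    qed
    show "col P i \<bullet> col P i = 1" if "i < n" for i
      using arg_cong[OF PP, of "\<lambda>B. B $$ (i, i)"] that P by simp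
    show "x \<bullet> x = (\<Sum>i<n. (col P i \<bullet> x)\<^sup>2)" if x: "x \<in> carrier_vec n" for x
    proof -
      \<comment> \<open>Insert the identity as \<open>P\<close> times its transpose and move
        \<open>P\<close> to the other factor.\<close>
      have "x \<bullet> x = (P *\<^sub>v (P\<^sup>T *\<^sub>v x)) \<bullet> x"
        using x P PT PP' by (simp flip: assoc_mult_mat_vec[of _ n n _ n])
      also have "\<dots> = (P\<^sup>T *\<^sub>v x) \<bullet> (P\<^sup>T *\<^sub>v x)"
        using transpose_vec_mult_scalar[of P n n "P\<^sup>T *\<^sub>v x" x] x P
        by (metis PT comm_scalar_prod mult_mat_vec_carrier)
      also have "\<dots> = (\<Sum>i<n. (col P i \<bullet> x)\<^sup>2)"
        using x P by (simp add: scalar_prod_def[of "P\<^sup>T *\<^sub>v x"] lessThan_atLeast0 power2_eq_square)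
      finally show ?thesis .
    qed
    have A_entry: "A $$ (i, i) = (\<Sum>l<n. f l * (P $$ (i, l))\<^sup>2)" if i: "i < n" for i
    proof -
      have "A = (P * mat_diag n f) * P\<^sup>T"
        unfolding AP[symmetric] assoc_mult_mat[OF A P PT] PP' using A by simp
      then have "A $$ (i, i) = ((P * mat_diag n f) * P\<^sup>T) $$ (i, i)" by simp
      also have "\<dots> = (\<Sum>l<n. f l * (P $$ (i, l))\<^sup>2)"
        unfolding mat_diag_mult_right[OF P] using i P
        by (simp add: scalar_prod_def lessThan_atLeast0 power2_eq_square mult_ac)
      finally show ?thesis .
    qed
    \<comment> \<open>After swapping the sums, \<open>f l\<close> is weighted by the squared norm of
      column \<open>l\<close>, which is 1.\<close>
    have "(\<Sum>i<n. A $$ (i, i)) = (\<Sum>l<n. \<Sum>i<n. f l * (P $$ (i, l))\<^sup>2)"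
      by (subst sum.swap) (simp add: A_entry)
    also have "\<dots> = (\<Sum>l<n. f l)"
    proof (rule sum.cong)
      fix l assume "l \<in> {..<n}"
      then have "(\<Sum>i<n. (P $$ (i, l))\<^sup>2) = 1"
        using arg_cong[OF PP, of "\<lambda>B. B $$ (l, l)"] P
        by (simp add: scalar_prod_def lessThan_atLeast0 power2_eq_square)
      then show "(\<Sum>i<n. f l * (P $$ (i, l))\<^sup>2) = f l" by (simp flip: sum_distrib_left)
    qed simp
    finally show "(\<Sum>i<n. f i) = (\<Sum>i<n. A $$ (i, i))" by simp
  qed (use P in auto)
qed

section \<open>Real inequalities for the energy\<close>

text \<open>Cauchy-Schwarz against the constant 1, read off from the nonnegative double sum of the
  squared differences.\<close>

lemma sum_squared_le_card_mult_sum_squares: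
  fixes g :: "'b \<Rightarrow> real"
  shows "(\<Sum>i\<in>I. g i)\<^sup>2 \<le> real (card I) * (\<Sum>i\<in>I. (g i)\<^sup>2)"
proof -
  have "0 \<le> (\<Sum>i\<in>I. \<Sum>j\<in>I. (g i - g j)\<^sup>2)" by (intro sum_nonneg) simp
  also have "\<dots> = 2 * (real (card I) * (\<Sum>i\<in>I. (g i)\<^sup>2)) - 2 * (\<Sum>i\<in>I. g i)\<^sup>2"
    by (simp add: power2_diff sum.distrib sum_subtractf power2_eq_square[of "sum g I"]
        mult.assoc sum_product flip: sum_distrib_left)
  finally show ?thesis by simp
qed

text \<open>The monotonicity of sqrt t + sqrt ((n - 1) (S - t)) is proved without calculus, by
  factoring differences of squares at the two points \<open>z\<close> and
  \<open>f j\<close>.\<close>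

lemma sqrt_energy_bound:
  fixes f :: "nat \<Rightarrow> real" and z S :: real
  assumes f0: "\<And>i. i < n \<Longrightarrow> f i \<ge> 0" and S: "(\<Sum>i<n. f i) = S"
    and j: "j < n" and zj: "z \<le> f j" and zS: "S \<le> real n * z" and z0: "z \<ge> 0"
  shows "(\<Sum>i<n. sqrt (f i)) \<le> sqrt z + sqrt ((real n - 1) * (S - z))"
proof -
  define N where "N = real n - 1"
  have N0: "N \<ge> 0" using j by (simp add: N_def)
  have split: "(\<Sum>i<n. g i) = g j + (\<Sum>i\<in>{..<n} - {j}. g i)" for g :: "nat \<Rightarrow> real"
    using j by (subst sum.remove[of _ j]) auto
  have rest: "(\<Sum>i\<in>{..<n} - {j}. f i) = S - f j" using S split[of f] by simp
  have rest0: "S - f j \<ge> 0" unfolding rest[symmetric] using f0 by (intro sum_nonneg) auto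
  have card: "real (card ({..<n} - {j})) = N" using j by (simp add: N_def of_nat_diff)
  have "(\<Sum>i\<in>{..<n} - {j}. sqrt (f i))\<^sup>2 \<le> N * (\<Sum>i\<in>{..<n} - {j}. (sqrt (f i))\<^sup>2)"
    using sum_squared_le_card_mult_sum_squares[of "\<lambda>i. sqrt (f i)" "{..<n} - {j}"]
    unfolding card .
  also have "(\<Sum>i\<in>{..<n} - {j}. (sqrt (f i))\<^sup>2) = S - f j"
    unfolding rest[symmetric] using f0 by (intro sum.cong) auto
  finally have cs: "(\<Sum>i\<in>{..<n} - {j}. sqrt (f i)) \<le> sqrt (N * (S - f j))"
    by (rule real_le_rsqrt)
  define a b c d where "a = sqrt (f j)" and "b = sqrt (N * (S - f j))"
    and "c = sqrt z" and "d = sqrt (N * (S - z))"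
  have nn: "a \<ge> 0" "b \<ge> 0" "c \<ge> 0" "d \<ge> 0"
    using f0[OF j] N0 rest0 z0 zj by (auto simp: a_def b_def c_def d_def)
  have sq: "a\<^sup>2 = f j" "b\<^sup>2 = N * (S - f j)" "c\<^sup>2 = z" "d\<^sup>2 = N * (S - z)"
    using f0[OF j] N0 rest0 z0 zj by (auto simp: a_def b_def c_def d_def)
  have ca: "c \<le> a" using zj by (simp add: a_def c_def)
  \<comment> \<open>The hypothesis \<open>S \<le> n z\<close> gives \<open>S - t \<le> N t\<close>.
    It is applied at \<open>t = f j\<close> and \<open>t = z\<close> to bound \<open>b\<close> and
    \<open>d\<close>.\<close>
  have bound: "sqrt (N * (S - t)) \<le> N * sqrt t" if "z \<le> t" for t
  proof -
    have "real n * z \<le> real n * t" using that by (intro mult_left_mono) auto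
    then have "S - t \<le> N * t" using zS by (simp add: N_def algebra_simps)
    then have "N * (S - t) \<le> (N * sqrt t)\<^sup>2"
      using N0 z0 that mult_left_mono[of "S - t" "N * t" N]
      by (simp add: power_mult_distrib power2_eq_square mult_ac)
    then show ?thesis using N0 z0 that by (intro real_le_lsqrt) auto
  qed
  have bN: "b \<le> N * a" and dN: "d \<le> N * c"
    unfolding a_def b_def c_def d_def using bound zj by auto
  \<comment> \<open>Both sides equal \<open>N * (f j - z)\<close>.\<close>
  have diff: "(d - b) * (d + b) = N * (a - c) * (a + c)"
    using sq by (simp add: algebra_simps power2_eq_square)
  have "a + b \<le> c + d"
  proof (cases "d + b = 0")
    case True
    then have "d = 0" "b = 0" using nn by linarith+
    then have "N * (S - z) = 0" "N * (S - f j) = 0" using sq(2,4) by simp_all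
    \<comment> \<open>\<open>N = 0\<close> means \<open>n = 1\<close>; then
      \<open>f j \<le> S \<le> z\<close>. For nonzero \<open>N\<close>, the two equations above give
      \<open>f j = S = z\<close>.\<close>
    moreover have "f j \<le> z" if "N = 0"
      using that zS rest0 by (simp add: N_def)
    ultimately have "f j = z" using zj by auto
    then show ?thesis using True nn by (simp add: a_def c_def)
  next
    case False
    then have pos: "d + b > 0" using nn by simp
    \<comment> \<open>Adding \<open>b \<le> N a\<close> and \<open>d \<le> N c\<close> bounds
      \<open>d + b\<close> by \<open>N (a + c)\<close>; the factor \<open>d + b\<close> is cancelled
      afterwards.\<close>
    have "(a - c) * (d + b) \<le> (a - c) * (N * (a + c))"
      using ca bN dN by (intro mult_left_mono) (auto simp: algebra_simps)
    also have "\<dots> = (d - b) * (d + b)" unfolding diff by simp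
    finally have "a - c \<le> d - b" using pos by (simp add: mult_le_cancel_right)
    then show ?thesis by simp
  qed
  moreover have "(\<Sum>i<n. sqrt (f i)) \<le> a + b"
    using cs split[of "\<lambda>i. sqrt (f i)"] by (simp add: a_def b_def)
  ultimately show ?thesis by (simp add: c_def d_def N_def)
qed

section \<open>Incidences, degrees and codegrees\<close>

lemma sum_from_nat_into:
  assumes "finite X"
  shows "(\<Sum>i<card X. g (from_nat_into X i)) = (\<Sum>x\<in>X. g x)"
  by (rule sum.reindex_bij_betw[OF bij_betw_from_nat_into_finite[OF assms]])

lemma gram_incidence_entry:
  assumes E: "finite E" and "i < card V" "j < card V"
  shows "(incidence_matrix V E * (incidence_matrix V E)\<^sup>T) $$ (i, j)
    = real (card {e \<in> E. from_nat_into V i \<in> e \<and> from_nat_into V j \<in> e})"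
proof -
  let ?v = "from_nat_into V"
  have "(incidence_matrix V E * (incidence_matrix V E)\<^sup>T) $$ (i, j)
    = (\<Sum>l<card E. if ?v i \<in> from_nat_into E l \<and> ?v j \<in> from_nat_into E l then 1 else 0)"
    using assms by (auto simp: incidence_matrix_def scalar_prod_def lessThan_atLeast0 intro!: sum.cong)
  also have "\<dots> = (\<Sum>e\<in>E. if ?v i \<in> e \<and> ?v j \<in> e then 1 else 0)"
    by (rule sum_from_nat_into[OF E])
  also have "\<dots> = real (card {e \<in> E. ?v i \<in> e \<and> ?v j \<in> e})"
    using E by (simp add: sum.If_cases Int_def)
  finally show ?thesis .
qed

text \<open>Double counting of incidences. Taken over all edges it gives the degree sum; taken over
  the edges through one vertex it gives a row sum of the Gram matrix.\<close>

lemma sum_card_Collect_mem: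
  assumes "finite V" "finite E" "\<And>e. e \<in> E \<Longrightarrow> e \<subseteq> V"
  shows "(\<Sum>v\<in>V. card {e \<in> E. v \<in> e}) = (\<Sum>e\<in>E. card e)"
proof -
  have "(\<Sum>v\<in>V. card {e \<in> E. v \<in> e}) = (\<Sum>v\<in>V. \<Sum>e\<in>E. if v \<in> e then 1 else 0)"
    using assms by (simp add: sum.If_cases Int_def)
  also have "\<dots> = (\<Sum>e\<in>E. \<Sum>v\<in>V. if v \<in> e then 1 else 0)" by (rule sum.swap)
  also have "\<dots> = (\<Sum>e\<in>E. card e)"
    using assms by (intro sum.cong) (auto simp: sum.If_cases Int_absorb1)
  finally show ?thesis .
qed

lemma uniform_hypergraphD:
  assumes "uniform_hypergraph k V E"
  shows "finite V" "finite E" "k \<ge> 2" "\<And>e. e \<in> E \<Longrightarrow> e \<subseteq> V" "\<And>e. e \<in> E \<Longrightarrow> card e = k"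
  using assms finite_subset[of E "Pow V"]
  unfolding uniform_hypergraph_def hypergraph_def by auto

lemma sum_hdegree:
  assumes H: "uniform_hypergraph k V E"
  shows "(\<Sum>v\<in>V. real (hdegree E v)) = real k * real (card E)"
proof -
  have "(\<Sum>v\<in>V. hdegree E v) = (\<Sum>e\<in>E. card e)"
    unfolding hdegree_def using uniform_hypergraphD[OF H] by (intro sum_card_Collect_mem) auto
  also have "\<dots> = k * card E" using uniform_hypergraphD(5)[OF H] by simp
  finally show ?thesis by (metis of_nat_mult of_nat_sum)
qed

text \<open>Deleting \<open>T\<close> is a bijection onto the subsets of \<open>V - T\<close> of
  size \<open>k - card T\<close>.\<close>

lemma card_supersets_of_size:
  assumes V: "finite V" and T: "T \<subseteq> V" "card T \<le> k"
  shows "card {e. e \<subseteq> V \<and> card e = k \<and> T \<subseteq> e} = (card V - card T) choose (k - card T)"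
proof -
  have fT: "finite T" using V T finite_subset by blast
  have "bij_betw (\<lambda>e. e - T) {e. e \<subseteq> V \<and> card e = k \<and> T \<subseteq> e}
      {e. e \<subseteq> V - T \<and> card e = k - card T}"
  proof (rule bij_betw_byWitness[where f' = "\<lambda>e. e \<union> T"])
    show "(\<lambda>e. e \<union> T) ` {e. e \<subseteq> V - T \<and> card e = k - card T}
      \<subseteq> {e. e \<subseteq> V \<and> card e = k \<and> T \<subseteq> e}"
    proof clarify
      fix e assume e: "e \<subseteq> V - T" "card e = k - card T"
      then have "finite e" using V finite_subset by blast
      then have "card (e \<union> T) = card e + card T" using e fT by (intro card_Un_disjoint) auto
      then show "e \<union> T \<subseteq> V \<and> card (e \<union> T) = k \<and> T \<subseteq> e \<union> T" using e T by auto
    qed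
  qed (use fT in \<open>auto simp: card_Diff_subset\<close>)
  then have "card {e. e \<subseteq> V \<and> card e = k \<and> T \<subseteq> e} = card {e. e \<subseteq> V - T \<and> card e = k - card T}"
    by (rule bij_betw_same_card)
  also have "\<dots> = card (V - T) choose (k - card T)" using V by (intro n_subsets) simp
  finally show ?thesis using T fT by (simp add: card_Diff_subset)
qed

text \<open>Degree and codegree are one count: edges that include \<open>{v, w}\<close>, a set of
  one or two elements.\<close>

lemma complete_codegree:
  assumes "complete_uniform_hypergraph k V E" "v \<in> V" "w \<in> V"
  shows "card {e \<in> E. v \<in> e \<and> w \<in> e}
    = (if v = w then (card V - 1) choose (k - 1) else (card V - 2) choose (k - 2))"
proof -
  have H: "uniform_hypergraph k V E" and E: "E = {e. e \<subseteq> V \<and> card e = k}"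
    using assms(1) unfolding complete_uniform_hypergraph_def by blast+
  note V = uniform_hypergraphD(1)[OF H] and k = uniform_hypergraphD(3)[OF H]
  have "{e \<in> E. v \<in> e \<and> w \<in> e} = {e. e \<subseteq> V \<and> card e = k \<and> {v, w} \<subseteq> e}"
    unfolding E by auto
  moreover have "card {v, w} = (if v = w then 1 else 2)" by auto
  ultimately show ?thesis
    using card_supersets_of_size[OF V, of "{v, w}" k] assms(2,3) k by auto
qed

section \<open>Matrices with constant diagonal and constant off-diagonal entries\<close>

text \<open>The prescribed sum forces \<open>p\<close> to be taken exactly once. This turns the
  trace into the sum of the square roots without counting multiplicities.\<close>

lemma two_valued_sum:
  fixes f :: "nat \<Rightarrow> real" and p q :: real
  assumes "p \<noteq> q" and f: "\<And>i. i < n \<Longrightarrow> f i = p \<or> f i = q"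
    and S: "(\<Sum>i<n. f i) = p + (real n - 1) * q"
  shows "(\<Sum>i<n. g (f i)) = g p + (real n - 1) * (g q :: real)"
proof -
  \<comment> \<open>on \<open>{p, q}\<close> the function \<open>g\<close> agrees with an affine function\<close>
  define s where "s = (g p - g q) / (p - q)"
  have "g (f i) = g q - s * q + s * f i" if "i < n" for i
  proof -
    have "s * (p - q) = g p - g q" using assms(1) by (simp add: s_def)
    then show ?thesis using f[OF that] by (auto simp: algebra_simps)
  qed
  then have "(\<Sum>i<n. g (f i)) = real n * (g q - s * q) + s * (p + (real n - 1) * q)"
    by (simp add: sum.distrib S flip: sum_distrib_left)
  also have "\<dots> = s * (p - q) + real n * g q" by (simp add: algebra_simps)
  also have "s * (p - q) = g p - g q" using assms(1) by (simp add: s_def)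
  finally show ?thesis by (simp add: algebra_simps)
qed

text \<open>Each row of the eigenvalue equation says that \<open>e - (a - b)\<close> times a
  coordinate is \<open>b s\<close>, with \<open>s\<close> the coordinate sum. If
  \<open>s = 0\<close>, a nonzero coordinate gives the second value; otherwise summing the rows and
  cancelling \<open>s\<close> gives the first.\<close>

lemma eigenvalue_scalar_plus_constant:
  fixes M :: "real mat"
  assumes M: "M = mat n n (\<lambda>(i, j). if i = j then a else b)"
    and u: "u \<in> carrier_vec n" "u \<bullet> u = 1" and Mu: "M *\<^sub>v u = e \<cdot>\<^sub>v u"
  shows "e = a - b + b * real n \<or> e = a - b"
proof -
  define s where "s = (\<Sum>j<n. u $ j)"
  have ev: "(e - (a - b)) * u $ i = b * s" if i: "i < n" for i
  proof -
    have "e * u $ i = (M *\<^sub>v u) $ i" unfolding Mu using i u by simp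
    also have "\<dots> = (\<Sum>j<n. (if i = j then a else b) * u $ j)"
      using i u by (simp add: M scalar_prod_def lessThan_atLeast0)
    also have "\<dots> = (\<Sum>j<n. b * u $ j + (if i = j then (a - b) * u $ j else 0))"
      by (rule sum.cong) (auto simp: algebra_simps)
    also have "\<dots> = b * s + (a - b) * u $ i"
      using i by (simp add: sum.distrib s_def sum_distrib_left)
    finally show ?thesis by (simp add: algebra_simps)
  qed
  show ?thesis
  proof (cases "s = 0")
    case True
    show ?thesis
    proof (rule ccontr)
      assume "\<not> ?thesis"
      then have "u $ i = 0" if "i < n" for i using ev[OF that] True by auto
      then have "u \<bullet> u = 0" using u(1) by (simp add: scalar_prod_def)
      then show False using u(2) by simp
    qed
  next
    case False
    have "(e - (a - b)) * s = (\<Sum>i<n. b * s)"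
      unfolding s_def sum_distrib_left by (rule sum.cong) (simp_all add: ev flip: s_def sum_distrib_left)
    then have "(e - (a - b)) * s = (b * real n) * s" by (simp add: mult_ac)
    then show ?thesis using False by simp
  qed
qed

section \<open>Spectrum of the Gram matrix and the upper bound\<close>

lemma gram_incidence_eigenvalues:
  assumes H: "uniform_hypergraph k V E"
  obtains f u where "sum_mset (singular_values (incidence_matrix V E)) = (\<Sum>i<card V. sqrt (f i))"
    and "\<And>i. i < card V \<Longrightarrow> f i \<ge> 0"
    and "(\<Sum>i<card V. f i) = real k * real (card E)"
    and "\<And>i. i < card V \<Longrightarrow> u i \<in> carrier_vec (card V)"
    and "\<And>i. i < card V \<Longrightarrow> u i \<bullet> u i = 1"
    and "\<And>i. i < card V \<Longrightarrow> incidence_matrix V E * (incidence_matrix V E)\<^sup>T *\<^sub>v u i = f i \<cdot>\<^sub>v u i"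
    and "\<And>x. x \<in> carrier_vec (card V) \<Longrightarrow> x \<bullet> x = (\<Sum>i<card V. (u i \<bullet> x)\<^sup>2)"
proof -
  note V = uniform_hypergraphD(1)[OF H] and E = uniform_hypergraphD(2)[OF H]
  define B where "B = incidence_matrix V E"
  define n where "n = card V"
  have B: "B \<in> carrier_mat n (card E)" by (simp add: B_def n_def incidence_matrix_def)
  have BT: "B\<^sup>T \<in> carrier_mat (card E) n" using B by simp
  have M: "B * B\<^sup>T \<in> carrier_mat n n" using B by simp
  have sym: "(B * B\<^sup>T)\<^sup>T = B * B\<^sup>T" using transpose_mult[OF B BT] by simp
  obtain f u where roots: "proots (char_poly (B * B\<^sup>T)) = mset (map f [0..<n])"
    and tr: "(\<Sum>i<n. f i) = (\<Sum>i<n. (B * B\<^sup>T) $$ (i, i))"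
    and u: "\<And>i. i < n \<Longrightarrow> u i \<in> carrier_vec n" "\<And>i. i < n \<Longrightarrow> u i \<bullet> u i = 1"
      "\<And>i. i < n \<Longrightarrow> B * B\<^sup>T *\<^sub>v u i = f i \<cdot>\<^sub>v u i"
      "\<And>x. x \<in> carrier_vec n \<Longrightarrow> x \<bullet> x = (\<Sum>i<n. (u i \<bullet> x)\<^sup>2)"
    by (rule symmetric_real_eigenbasis[OF M sym]) (rule that)
  show thesis
  proof (rule that[of f u])
    show "sum_mset (singular_values (incidence_matrix V E)) = (\<Sum>i<card V. sqrt (f i))"
      unfolding singular_values_def B_def[symmetric] roots n_def[symmetric]
      by (simp add: lessThan_atLeast0 sum_unfold_sum_mset multiset.map_comp comp_def)
    show "f i \<ge> 0" if "i < card V" for i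
    proof -
      have i: "i < n" using that by (simp add: n_def)
      \<comment> \<open>As \<open>u i\<close> has unit length, \<open>f i\<close> is the squared
        norm of the transpose of \<open>B\<close> applied to \<open>u i\<close>.\<close>
      have "f i = (B * B\<^sup>T *\<^sub>v u i) \<bullet> u i" using u(1,2,3)[OF i] by simp
      also have "\<dots> = (B *\<^sub>v (B\<^sup>T *\<^sub>v u i)) \<bullet> u i" using u(1)[OF i] B BT by simp
      also have "\<dots> = (B\<^sup>T *\<^sub>v u i) \<bullet> (B\<^sup>T *\<^sub>v u i)"
        using transpose_vec_mult_scalar[OF B, of "B\<^sup>T *\<^sub>v u i" "u i"] u(1)[OF i] BT
        by (simp add: comm_scalar_prod[of "u i" n])
      also have "\<dots> \<ge> 0" by (simp add: scalar_prod_def sum_nonneg)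
      finally show ?thesis .
    qed
    have "(\<Sum>i<n. f i) = (\<Sum>i<n. real (card {e \<in> E. from_nat_into V i \<in> e}))"
      unfolding tr unfolding B_def n_def using E by (intro sum.cong) (simp_all add: gram_incidence_entry)
    also have "\<dots> = (\<Sum>v\<in>V. real (hdegree E v))"
      unfolding n_def hdegree_def by (rule sum_from_nat_into[OF V])
    also have "\<dots> = real k * real (card E)" by (rule sum_hdegree[OF H])
    finally show "(\<Sum>i<card V. f i) = real k * real (card E)" by (simp add: n_def)
  qed (use u in \<open>auto simp: n_def B_def\<close>)
qed

text \<open>The row sum at a vertex \<open>v\<close> counts pairs of an edge through
  \<open>v\<close> and a vertex of that edge; each such edge contributes \<open>k\<close>.\<close>

lemma gram_incidence_mult_ones:
  assumes H: "uniform_hypergraph k V E"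
  shows "incidence_matrix V E * (incidence_matrix V E)\<^sup>T *\<^sub>v vec (card V) (\<lambda>_. 1)
    = vec (card V) (\<lambda>i. real k * real (hdegree E (from_nat_into V i)))"
proof (rule eq_vecI)
  note V = uniform_hypergraphD(1)[OF H] and E = uniform_hypergraphD(2)[OF H]
    and EV = uniform_hypergraphD(4)[OF H] and card = uniform_hypergraphD(5)[OF H]
  let ?v = "from_nat_into V"
  let ?M = "incidence_matrix V E * (incidence_matrix V E)\<^sup>T"
  have M: "?M \<in> carrier_mat (card V) (card V)"
    by (intro carrier_matI) (simp_all add: incidence_matrix_def)
  fix i assume "i < dim_vec (vec (card V) (\<lambda>i. real k * real (hdegree E (?v i))))"
  then have i: "i < card V" by simp
  have "(?M *\<^sub>v vec (card V) (\<lambda>_. 1)) $ i = row ?M i \<bullet> vec (card V) (\<lambda>_. 1)"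
    by (rule index_mult_mat_vec) (use i M in \<open>simp only: carrier_matD\<close>)
  also have "\<dots> = (\<Sum>j<card V. ?M $$ (i, j))"
    unfolding scalar_prod_def lessThan_atLeast0 by (rule sum.cong) (use i M in auto)
  also have "\<dots> = (\<Sum>j<card V. real (card {e \<in> {e \<in> E. ?v i \<in> e}. ?v j \<in> e}))"
    by (rule sum.cong) (use i in \<open>simp_all add: gram_incidence_entry[OF E] conj_assoc\<close>)
  also have "\<dots> = real (\<Sum>w\<in>V. card {e \<in> {e \<in> E. ?v i \<in> e}. w \<in> e})"
    unfolding of_nat_sum by (rule sum_from_nat_into[OF V])
  also have "(\<Sum>w\<in>V. card {e \<in> {e \<in> E. ?v i \<in> e}. w \<in> e}) = (\<Sum>e\<in>{e \<in> E. ?v i \<in> e}. card e)"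
    by (rule sum_card_Collect_mem) (use V E EV in auto)
  also have "\<dots> = k * hdegree E (?v i)" by (simp add: card hdegree_def)
  finally show "(?M *\<^sub>v vec (card V) (\<lambda>_. 1)) $ i
      = vec (card V) (\<lambda>i. real k * real (hdegree E (?v i))) $ i" using i by simp
qed (simp add: incidence_matrix_def)

lemma incidence_energy_le:
  assumes H: "uniform_hypergraph k V E" and ne: "E \<noteq> {}"
  shows "incidence_energy V E \<le> sqrt (frak_zagreb k V E)
    + sqrt ((real (card V) - 1) * (real k * real (card E) - frak_zagreb k V E))"
proof -
  note V = uniform_hypergraphD(1)[OF H] and k = uniform_hypergraphD(3)[OF H]
    and EV = uniform_hypergraphD(4)[OF H] and card = uniform_hypergraphD(5)[OF H]
  define n where "n = card V"
  define M where "M = incidence_matrix V E * (incidence_matrix V E)\<^sup>T"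
  define Z where "Z = real (zagreb_index V E)"
  have n: "n > 0"
  proof -
    obtain e where "e \<in> E" using ne by blast
    then have "e \<subseteq> V" "e \<noteq> {}" using EV card k by fastforce+
    then show ?thesis using V by (auto simp: n_def card_gt_0_iff)
  qed
  obtain f u where energy: "sum_mset (singular_values (incidence_matrix V E)) = (\<Sum>i<n. sqrt (f i))"
    and f0: "\<And>i. i < n \<Longrightarrow> f i \<ge> 0"
    and S: "(\<Sum>i<n. f i) = real k * real (card E)"
    and u: "\<And>i. i < n \<Longrightarrow> u i \<in> carrier_vec n" "\<And>i. i < n \<Longrightarrow> u i \<bullet> u i = 1"
    and Mu: "\<And>i. i < n \<Longrightarrow> M *\<^sub>v u i = f i \<cdot>\<^sub>v u i"
    and parseval: "\<And>x. x \<in> carrier_vec n \<Longrightarrow> x \<bullet> x = (\<Sum>i<n. (u i \<bullet> x)\<^sup>2)"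
    by (rule gram_incidence_eigenvalues[OF H, folded n_def M_def]) (rule that)
  obtain j where j: "j < n" and jmax: "\<And>i. i < n \<Longrightarrow> f i \<le> f j"
  proof -
    have "Max (f ` {..<n}) \<in> f ` {..<n}" using n by (intro Max_in) auto
    then obtain j where "j < n" "f j = Max (f ` {..<n})" by auto
    then show thesis using that by simp
  qed
  let ?x = "vec n (\<lambda>_. 1 :: real)"
  have M: "M \<in> carrier_mat n n"
    by (intro carrier_matI) (simp_all add: M_def n_def incidence_matrix_def)
  have BT: "(incidence_matrix V E)\<^sup>T \<in> carrier_mat (card E) n"
    and B: "incidence_matrix V E \<in> carrier_mat n (card E)"
    by (simp_all add: n_def incidence_matrix_def)
  have MT: "M\<^sup>T = M" unfolding M_def using transpose_mult[OF B BT] by simp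
  \<comment> \<open>The squared norm of \<open>M\<close> applied to the all-ones vector is computed
    directly, then expanded in the eigenbasis and bounded by the largest eigenvalue.\<close>
  have "real k ^ 2 * Z = (\<Sum>v\<in>V. (real k * real (hdegree E v))\<^sup>2)"
    by (simp add: Z_def zagreb_index_def power_mult_distrib sum_distrib_left)
  also have "\<dots> = (\<Sum>i<n. (real k * real (hdegree E (from_nat_into V i)))\<^sup>2)"
    unfolding n_def by (rule sum_from_nat_into[OF V, symmetric])
  also have "\<dots> = (M *\<^sub>v ?x) \<bullet> (M *\<^sub>v ?x)"
    unfolding M_def n_def gram_incidence_mult_ones[OF H]
    by (simp add: scalar_prod_def lessThan_atLeast0 power2_eq_square)
  also have "\<dots> = (\<Sum>i<n. (u i \<bullet> (M *\<^sub>v ?x))\<^sup>2)"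
    by (rule parseval) (use M in simp)
  also have "\<dots> = (\<Sum>i<n. (f i)\<^sup>2 * (u i \<bullet> ?x)\<^sup>2)"
  proof (rule sum.cong)
    fix i assume "i \<in> {..<n}"
    then have i: "i < n" by simp
    have "u i \<bullet> (M *\<^sub>v ?x) = (M *\<^sub>v u i) \<bullet> ?x"
      using transpose_vec_mult_scalar[OF M, of ?x "u i"] u(1)[OF i] MT by simp
    then show "(u i \<bullet> (M *\<^sub>v ?x))\<^sup>2 = (f i)\<^sup>2 * (u i \<bullet> ?x)\<^sup>2"
      using u(1)[OF i] Mu[OF i] by (simp add: power_mult_distrib)
  qed simp
  \<comment> \<open>Nonnegativity of the eigenvalues lets the maximality of \<open>f j\<close> pass
    to squares.\<close>
  also have "\<dots> \<le> (\<Sum>i<n. (f j)\<^sup>2 * (u i \<bullet> ?x)\<^sup>2)"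
    using f0 jmax by (intro sum_mono mult_right_mono power_mono) auto
  also have "\<dots> = (f j)\<^sup>2 * (?x \<bullet> ?x)" by (simp add: parseval sum_distrib_left)
  also have "?x \<bullet> ?x = real n" by (simp add: scalar_prod_def)
  finally have "real k ^ 2 * (Z / real n) \<le> (f j)\<^sup>2" using n by (simp add: field_simps)
  then have "(frak_zagreb k V E)\<^sup>2 \<le> (f j)\<^sup>2"
    by (simp add: frak_zagreb_def Z_def n_def power_mult_distrib)
  then have zj: "frak_zagreb k V E \<le> f j" using f0[OF j] by (rule power2_le_imp_le)
  have z0: "frak_zagreb k V E \<ge> 0" by (simp add: frak_zagreb_def)
  \<comment> \<open>The degrees sum to \<open>k m\<close>, so Cauchy-Schwarz gives
    \<open>k m \<le> n sqrt (Z / n)\<close>; the factor \<open>k \<ge> 1\<close> in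
    \<open>frak_zagreb\<close> only enlarges the right side.\<close>
  have zS: "real k * real (card E) \<le> real n * frak_zagreb k V E"
  proof -
    have "(real k * real (card E))\<^sup>2 \<le> real n * Z"
      using sum_squared_le_card_mult_sum_squares[of "\<lambda>v. real (hdegree E v)" V] sum_hdegree[OF H]
      by (simp add: n_def Z_def zagreb_index_def)
    also have "\<dots> = (real n * sqrt (1 / real n * Z))\<^sup>2"
      using n unfolding power_mult_distrib by (simp add: Z_def power2_eq_square[of "real n"])
    finally have "real k * real (card E) \<le> real n * sqrt (1 / real n * Z)"
      by (rule power2_le_imp_le) (simp add: Z_def)
    also have "\<dots> \<le> real n * frak_zagreb k V E"
    proof (intro mult_left_mono)
      have "1 * sqrt (1 / real n * Z) \<le> real k * sqrt (1 / real n * Z)"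
        using k by (intro mult_right_mono) (auto simp: Z_def)
      then show "sqrt (1 / real n * Z) \<le> frak_zagreb k V E"
        by (simp add: frak_zagreb_def Z_def n_def)
    qed simp
    finally show ?thesis .
  qed
  show ?thesis
    using sqrt_energy_bound[of n f, OF f0 S j zj zS z0] ne
    by (simp add: incidence_energy_def energy n_def)
qed

section \<open>Equality for complete hypergraphs\<close>

lemma incidence_energy_complete:
  assumes C: "complete_uniform_hypergraph k V E" and ne: "E \<noteq> {}"
  shows "incidence_energy V E = sqrt (frak_zagreb k V E)
    + sqrt ((real (card V) - 1) * (real k * real (card E) - frak_zagreb k V E))"
proof -
  have H: "uniform_hypergraph k V E" using C unfolding complete_uniform_hypergraph_def by blast
  note V = uniform_hypergraphD(1)[OF H] and E = uniform_hypergraphD(2)[OF H]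
    and k = uniform_hypergraphD(3)[OF H] and EV = uniform_hypergraphD(4)[OF H]
    and card = uniform_hypergraphD(5)[OF H]
  define n where "n = card V"
  define M where "M = incidence_matrix V E * (incidence_matrix V E)\<^sup>T"
  obtain e where "e \<in> E" using ne by blast
  then have kn: "k \<le> n" using EV card card_mono[OF V] unfolding n_def by blast
  define a where "a = real ((n - 1) choose (k - 1))"
  define b where "b = real ((n - 2) choose (k - 2))"
  \<comment> \<open>Positivity of the codegree will separate the two eigenvalues.\<close>
  have b0: "b > 0" unfolding b_def using kn k by simp
  \<comment> \<open>Absorption identity for binomials: both sides count pairs of an edge through a
    fixed vertex and another vertex of it.\<close>
  have ab: "(real n - 1) * b = (real k - 1) * a"
  proof -
    have "(k - 1) * ((n - 1) choose (k - 1)) = (n - 1) * ((n - 2) choose (k - 2))"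
      using times_binomial_minus1_eq[of "k - 1" "n - 1"] k by (simp add: numeral_2_eq_2)
    then have "real (k - 1) * a = real (n - 1) * b"
      unfolding a_def b_def by (metis of_nat_mult)
    then show ?thesis using k kn by (simp add: of_nat_diff)
  qed
  obtain f u where energy: "sum_mset (singular_values (incidence_matrix V E)) = (\<Sum>i<n. sqrt (f i))"
    and "\<And>i. i < n \<Longrightarrow> f i \<ge> 0"
    and S: "(\<Sum>i<n. f i) = real k * real (card E)"
    and u: "\<And>i. i < n \<Longrightarrow> u i \<in> carrier_vec n" "\<And>i. i < n \<Longrightarrow> u i \<bullet> u i = 1"
    and Mu: "\<And>i. i < n \<Longrightarrow> M *\<^sub>v u i = f i \<cdot>\<^sub>v u i"
    and "\<And>x. x \<in> carrier_vec n \<Longrightarrow> x \<bullet> x = (\<Sum>i<n. (u i \<bullet> x)\<^sup>2)"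
    by (rule gram_incidence_eigenvalues[OF H, folded n_def M_def]) (rule that)
  have inV: "from_nat_into V i \<in> V" if "i < n" for i
    using that bij_betw_from_nat_into_finite[OF V] unfolding bij_betw_def n_def by auto
  have inj: "from_nat_into V i = from_nat_into V j \<longleftrightarrow> i = j" if "i < n" "j < n" for i j
    using that bij_betw_from_nat_into_finite[OF V] unfolding bij_betw_def n_def inj_on_def by auto
  have M: "M = mat n n (\<lambda>(i, j). if i = j then a else b)"
  proof (rule eq_matI)
    fix i j assume "i < dim_row (mat n n (\<lambda>(i, j). if i = j then a else b))"
      "j < dim_col (mat n n (\<lambda>(i, j). if i = j then a else b))"
    then have ij: "i < n" "j < n" by auto
    then show "M $$ (i, j) = mat n n (\<lambda>(i, j). if i = j then a else b) $$ (i, j)"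
      using gram_incidence_entry[OF E, of i V j] complete_codegree[OF C inV[OF ij(1)] inV[OF ij(2)]]
        inj[OF ij] unfolding M_def n_def[symmetric] a_def b_def by simp
  qed (simp_all add: M_def n_def incidence_matrix_def)
  have deg: "real (hdegree E v) = a" if "v \<in> V" for v
    using complete_codegree[OF C that that] by (simp add: hdegree_def a_def n_def)
  have km: "real k * real (card E) = real n * a"
    using sum_hdegree[OF H] by (simp add: deg n_def)
  \<comment> \<open>The hypergraph is regular, so the mean of the squared degrees is
    \<open>a\<^sup>2\<close>.\<close>
  have z: "frak_zagreb k V E = real k * a"
  proof -
    have "real (zagreb_index V E) = real n * a\<^sup>2"
      by (simp add: zagreb_index_def deg n_def)
    moreover have "a \<ge> 0" by (simp add: a_def)
    ultimately show ?thesis using k kn by (simp add: frak_zagreb_def flip: n_def)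
  qed
  have top: "a - b + b * real n = real k * a" using ab by (simp add: algebra_simps)
  have vals: "f i = real k * a \<or> f i = a - b" if "i < n" for i
    using eigenvalue_scalar_plus_constant[OF M u(1)[OF that] u(2)[OF that] Mu[OF that]]
    unfolding top .
  have neq: "real k * a \<noteq> a - b" unfolding top[symmetric] using b0 kn k by simp
  \<comment> \<open>This is the trace that a simple eigenvalue \<open>k a\<close> would give, the
    form required by \<open>two_valued_sum\<close>.\<close>
  have trace: "(\<Sum>i<n. f i) = real k * a + (real n - 1) * (a - b)"
    unfolding S km using ab by (simp add: algebra_simps)
  have "(\<Sum>i<n. sqrt (f i)) = sqrt (real k * a) + (real n - 1) * sqrt (a - b)"
    by (rule two_valued_sum[OF neq vals trace])
  also have "(real n - 1) * sqrt (a - b) = sqrt ((real n - 1)\<^sup>2 * (a - b))"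
    using k kn by (simp add: real_sqrt_mult)
  also have "(real n - 1)\<^sup>2 * (a - b) = (real n - 1) * (real n * a - real k * a)"
  proof -
    have "(real n - 1) * (a - b) = real n * a - real k * a" using ab by (simp add: algebra_simps)
    then show ?thesis by (simp add: power2_eq_square)
  qed
  finally show ?thesis using ne
    by (simp add: incidence_energy_def energy z km flip: n_def)
qed

theorem theorem18:
  fixes V :: "'a set" and E :: "'a set set" and k n m :: nat
  assumes "uniform_hypergraph k V E"
    and "card V = n"
    and "card E = m"
  shows "incidence_energy V E \<le> sqrt (frak_zagreb k V E)
           + sqrt ((real n - 1) * (real k * real m - frak_zagreb k V E))
       \<and> (complete_uniform_hypergraph k V E \<longrightarrow>
           incidence_energy V E = sqrt (frak_zagreb k V E)
             + sqrt ((real n - 1) * (real k * real m - frak_zagreb k V E)))"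
proof (cases "E = {}")
  \<comment> \<open>Without edges both sides vanish. This case includes \<open>n = 0\<close> and
    complete hypergraphs with \<open>k > n\<close>.\<close>
  case True
  then have "frak_zagreb k V E = 0"
    by (simp add: frak_zagreb_def zagreb_index_def hdegree_def)
  then show ?thesis using True assms(3) by (auto simp: incidence_energy_def)
next
  case False
  then show ?thesis
    using incidence_energy_le[OF assms(1) False] incidence_energy_complete[of k V E, OF _ False]
    unfolding assms(2,3) by blast
qed

end
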